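(* Let $T=\overline{T}_{i,j,m}$ be the almost representative hat with vertices $A=(0,0)$, $B=(i,j)$, $C=(m,0)$, and let $T'=\overline{T}_{k,l,n}$ be the almost representative hat with vertices $(0,0)$, $(k,l)$, $(n,0)$, where $i,k$ are arbitrary integers and $j,m,l,n$ are positive odd integers. Assume that $T$ and $T'$ have equal or oppositely oriented boundary types and that the areas of their convex $\mathbb{R}$-hulls are equal. Let $\iota$ be a bijection from the vertex set of $T$ onto the vertex set of $T'$, and write $A'=\iota(A)$, $B'=\iota(B)$, $C'=\iota(C)$. Say that $\iota$ \emph{is an isomorphism} if it is the restriction to vertices of a (groupoid) isomorphism $T\to T'$. Write $\iota: ABC\to XYZ$, where $XYZ$ is a permutation of $A',B',C'$, to mean that $X=(0,0)$, $Y=(k,l)$ and $Z=(n,0)$. Then $\iota$ is of one of the following six kinds, and in each case the stated criterion holds. (a) If $\iota: ABC\to A'B'C'$, then $\iota$ is an isomorphism precisely when $l=j$, $n=m$ and $k=i+jp$ for some integer $p$. (b) If $\iota: ABC\to C'B'A'$, then $\iota$ is an isomorphism precisely when $l=j$, $n=m$ and $k=m-i+jp$ for some integer $p$. (c) If $\iota: ABC\to A'C'B'$, then $\iota$ is an isomorphism precisely when $n=\gcd\{i,j\}$, $l=mj/n$ and $k=am$ for some integer $a$ that is a solution of $ai\equiv n\pmod{j}$. (d) If $\iota: ABC\to C'A'B'$, then $\iota$ is an isomorphism precisely when $n=\gcd\{m-i,j\}$, $l=mj/n$ and $k=am$ for some integer $a$ that is a solution of $a(m-i)\equiv n\pmod{j}$.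 (e) If $\iota: ABC\to B'C'A'$, then $\iota$ is an isomorphism precisely when $n=\gcd\{i,j\}$, $l=mj/n$ and $k=n-am$ for some integer $a$ that is a solution of $ai\equiv n\pmod{j}$. (f) If $\iota: ABC\to B'A'C'$, then $\iota$ is an isomorphism precisely when $n=\gcd\{m-i,j\}$, $l=mj/n$ and $k=n-am$ for some integer $a$ that is a solution of $a(m-i)\equiv n\pmod{j}$.
   Context: $\mathbb{D}=\mathbb{Z}[1/2]$ is the ring of dyadic rationals. A dyadic triangle is the intersection with $\mathbb{D}^2$ of a nondegenerate real triangle whose vertices lie in $\mathbb{D}^2$; the real triangle is its convex $\mathbb{R}$-hull. It is regarded as a groupoid under $x\circ y=\frac12(x+y)$. Isomorphisms are bijections preserving $\circ$; equivalently, they are restrictions of automorphisms of the affine $\mathbb{D}$-space $\mathbb{D}^2$, that is, of maps $x\mapsto xM+v$ with $M\in \mathrm{GL}(2,\mathbb{D})$, $v\in\mathbb{D}^2$. For an integer $i$ and positive odd integers $j,m$, the almost representative hat $\overline{T}_{i,j,m}$ is the dyadic triangle with vertices $(0,0),(i,j),(m,0)$. Every nontrivial dyadic interval (the set of points of $\mathbb{D}^2$ on a segment with distinct endpoints in $\mathbb{D}^2$) is isomorphic, under $\circ$, to $[0,q]\cap\mathbb{D}$ for a unique positive odd integer $q$, called its type. A dyadic triangle with vertices $P,Q,R$ ordered clockwise has boundary type equal to the triple of types of its sides $(PQ,QR,RP)$, considered up to cyclic order; two boundary types are oppositely oriented if one is obtained from the other by reversing the cyclic order. *)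

theory Defs
  imports "HOL-Analysis.Analysis" "HOL-Number_Theory.Cong"
begin

definition dyadics :: "real set" where
  "dyadics = {of_int a / 2 ^ s | (a :: int) (s :: nat). True}"

definition dyadic_plane :: "(real ^ 2) set" where
  "dyadic_plane = {x. \<forall>c. x $ c \<in> dyadics}"

text \<open>The groupoid operation is \<^const>\<open>midpoint\<close>. It is available in every real vector space,
  so the same notion of isomorphism relates subsets of the plane and subsets of the line.\<close>

definition groupoid_iso ::
    "('a::real_vector \<Rightarrow> 'b::real_vector) \<Rightarrow> 'a set \<Rightarrow> 'b set \<Rightarrow> bool" where
  "groupoid_iso f S T \<longleftrightarrow>
     bij_betw f S T \<and> (\<forall>x\<in>S. \<forall>y\<in>S. f (midpoint x y) = midpoint (f x) (f y))"

definition dyadic_interval :: "real ^ 2 \<Rightarrow> real ^ 2 \<Rightarrow> (real ^ 2) set" where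
  "dyadic_interval P Q = closed_segment P Q \<inter> dyadic_plane"

definition interval_type :: "(real ^ 2) set \<Rightarrow> int" where
  "interval_type S =
     (THE q. q > 0 \<and> odd q \<and> (\<exists>f. groupoid_iso f S ({0..real_of_int q} \<inter> dyadics)))"

definition dyadic_triangle :: "real ^ 2 \<Rightarrow> real ^ 2 \<Rightarrow> real ^ 2 \<Rightarrow> (real ^ 2) set" where
  "dyadic_triangle P Q R = (convex hull {P, Q, R}) \<inter> dyadic_plane"

text \<open>Strict negativity of the signed area also makes the triangle nondegenerate.\<close>

definition clockwise :: "real ^ 2 \<Rightarrow> real ^ 2 \<Rightarrow> real ^ 2 \<Rightarrow> bool" where
  "clockwise P Q R \<longleftrightarrow>
     (Q $ 1 - P $ 1) * (R $ 2 - P $ 2) - (Q $ 2 - P $ 2) * (R $ 1 - P $ 1) < 0"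

text \<open>The vertices of a triangle can be listed clockwise in exactly three ways, which differ by
  rotation. A triple up to cyclic order is therefore encoded as the set of the triples arising
  from all these listings.\<close>

definition boundary_type :: "(real ^ 2) set \<Rightarrow> (int \<times> int \<times> int) set" where
  "boundary_type T =
     {(interval_type (dyadic_interval P Q),
       interval_type (dyadic_interval Q R),
       interval_type (dyadic_interval R P)) | P Q R.
        P \<in> dyadic_plane \<and> Q \<in> dyadic_plane \<and> R \<in> dyadic_plane \<and>
        clockwise P Q R \<and> T = dyadic_triangle P Q R}"

definition oppositely_oriented ::
    "(int \<times> int \<times> int) set \<Rightarrow> (int \<times> int \<times> int) set \<Rightarrow> bool" where
  "oppositely_oriented U V \<longleftrightarrow> V = (\<lambda>(a, b, c). (c, b, a)) ` U"

definition int_point :: "int \<Rightarrow> int \<Rightarrow> real ^ 2" where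
  "int_point x y = vector [real_of_int x, real_of_int y]"

definition hat :: "int \<Rightarrow> int \<Rightarrow> int \<Rightarrow> (real ^ 2) set" where
  "hat i j m = dyadic_triangle (int_point 0 0) (int_point i j) (int_point m 0)"

definition hat_vertices :: "int \<Rightarrow> int \<Rightarrow> int \<Rightarrow> (real ^ 2) set" where
  "hat_vertices i j m = {int_point 0 0, int_point i j, int_point m 0}"

text \<open>For a bijection \<open>\<iota>\<close> from the vertices of a hat, \<open>maps_onto_hat k l n X Y Z\<close>, with
  \<open>X, Y, Z\<close> a permutation of the images \<open>A', B', C'\<close>, is the notation \<open>\<iota>: ABC \<rightarrow> XYZ\<close>.\<close>

definition maps_onto_hat ::
    "int \<Rightarrow> int \<Rightarrow> int \<Rightarrow> real ^ 2 \<Rightarrow> real ^ 2 \<Rightarrow> real ^ 2 \<Rightarrow> bool" where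
  "maps_onto_hat k l n X Y Z \<longleftrightarrow>
     X = int_point 0 0 \<and> Y = int_point k l \<and> Z = int_point n 0"

definition extends_to_iso ::
    "(real ^ 2 \<Rightarrow> real ^ 2) \<Rightarrow> (real ^ 2) set \<Rightarrow> (real ^ 2) set \<Rightarrow> (real ^ 2) set \<Rightarrow> bool" where
  "extends_to_iso \<iota> V T T' \<longleftrightarrow> (\<exists>f. groupoid_iso f T T' \<and> (\<forall>v\<in>V. f v = \<iota> v))"

end

theory Submission
  imports Defs
begin

text \<open>
  A midpoint homomorphism sends finite arithmetic progressions inside its domain to arithmetic
  progressions, and near the vertex \<open>A\<close> of the hat it is additive. Comparing the values on
  suitably small dyadic multiples shows that the vertex images of an isomorphism satisfy
  \<open>C' - A' = m w\<^sub>1\<close> and \<open>B' - A' = i w\<^sub>1 + j w\<^sub>2\<close> with \<open>w\<^sub>1, w\<^sub>2\<close> in the dyadic plane; as \<open>m\<close> and \<open>j\<close>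
  are odd and the vertices are integral, \<open>w\<^sub>1\<close> and \<open>w\<^sub>2\<close> are integral. Conversely, since the areas
  agree, the integer matrix with rows \<open>w\<^sub>1, w\<^sub>2\<close> has determinant \<open>1\<close> or \<open>-1\<close>, so it induces an
  isomorphism. The criteria are then solvability conditions for integer equations with
  \<open>j m = l n\<close>; kinds (b), (d), (e), (f) reduce to (a) and (c) by the reflections
  \<open>i \<mapsto> m - i\<close> and \<open>k \<mapsto> n - k\<close>.
\<close>

section \<open>Arithmetic of dyadic rationals and of the dyadic plane\<close>

lemma dyadicsI: "x * 2 ^ s = of_int a \<Longrightarrow> x \<in> dyadics"
  unfolding dyadics_def by (intro CollectI exI[of _ a] exI[of _ s]) (simp add: field_simps)

lemma dyadicsE:
  assumes "x \<in> dyadics"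
  obtains a s where "x * 2 ^ s = of_int a"
proof -
  from assms obtain a s where "x = of_int a / 2 ^ s"
    by (auto simp: dyadics_def)
  then show ?thesis by (intro that[of s a]) simp
qed

lemma dyadics_of_int [simp]: "of_int a \<in> dyadics"
  by (rule dyadicsI[of _ 0 a]) simp

lemma dyadics_inverse_two_power: "1 / 2 ^ t \<in> dyadics"
  by (rule dyadicsI[of _ t 1]) simp

lemma dyadics_add:
  assumes "x \<in> dyadics" "y \<in> dyadics"
  shows "x + y \<in> dyadics"
proof -
  from assms obtain a s b t where "x * 2 ^ s = of_int a" "y * 2 ^ t = of_int b"
    by (metis dyadicsE)
  moreover have "(x + y) * 2 ^ (s + t) = (x * 2 ^ s) * 2 ^ t + (y * 2 ^ t) * 2 ^ s"
    by (simp add: power_add algebra_simps)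
  ultimately have "(x + y) * 2 ^ (s + t) = of_int (a * 2 ^ t + b * 2 ^ s)"
    by simp
  then show ?thesis by (rule dyadicsI)
qed

lemma dyadics_mult:
  assumes "x \<in> dyadics" "y \<in> dyadics"
  shows "x * y \<in> dyadics"
proof -
  from assms obtain a s b t where "x * 2 ^ s = of_int a" "y * 2 ^ t = of_int b"
    by (metis dyadicsE)
  moreover have "(x * y) * 2 ^ (s + t) = (x * 2 ^ s) * (y * 2 ^ t)"
    by (simp add: power_add)
  ultimately have "(x * y) * 2 ^ (s + t) = of_int (a * b)"
    by simp
  then show ?thesis by (rule dyadicsI)
qed

lemma dyadics_diff:
  assumes "x \<in> dyadics" "y \<in> dyadics"
  shows "x - y \<in> dyadics"
  using dyadics_add[OF assms(1) dyadics_mult[OF dyadics_of_int[of "-1"] assms(2)]] by simp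

text \<open>An odd factor cannot cancel a power of two in a denominator. This is how the oddness of
  \<open>m\<close> and \<open>j\<close> turns dyadic coordinates into integers.\<close>

lemma dyadic_odd_multiple_int:
  assumes "x \<in> dyadics" "odd q" "of_int q * x = of_int b"
  shows "x \<in> \<int>"
proof -
  from assms(1) obtain a s where a: "x * 2 ^ s = of_int a"
    by (rule dyadicsE)
  have "of_int (q * a) = (of_int (b * 2 ^ s) :: real)"
    using a assms(3) by (simp add: mult.assoc[symmetric] flip: a assms(3))
  then have "q * a = b * 2 ^ s"
    by (simp only: of_int_eq_iff)
  moreover have "coprime (2 ^ s) q"
    using assms(2) by simp
  ultimately have "2 ^ s dvd a"
    by (metis coprime_dvd_mult_right_iff dvd_triv_right)
  then obtain c where "a = 2 ^ s * c" by auto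
  with a have "x = of_int c" by simp
  then show ?thesis by simp
qed

lemma int_point_nth [simp]: "int_point x y $ 1 = of_int x" "int_point x y $ 2 = of_int y"
  by (simp_all add: int_point_def)

lemma dyadic_plane_iff: "x \<in> dyadic_plane \<longleftrightarrow> x $ 1 \<in> dyadics \<and> x $ 2 \<in> dyadics"
  by (simp add: dyadic_plane_def forall_2)

lemma int_point_dyadic [simp]: "int_point x y \<in> dyadic_plane"
  by (simp add: dyadic_plane_iff)

lemma dyadic_plane_diff: "x \<in> dyadic_plane \<Longrightarrow> y \<in> dyadic_plane \<Longrightarrow> x - y \<in> dyadic_plane"
  by (simp add: dyadic_plane_iff dyadics_diff)

lemma dyadic_plane_scaleR: "c \<in> dyadics \<Longrightarrow> x \<in> dyadic_plane \<Longrightarrow> c *\<^sub>R x \<in> dyadic_plane"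
  by (simp add: dyadic_plane_iff dyadics_mult)

section \<open>Local additivity of midpoint homomorphisms\<close>

text \<open>Each term of the progression is the midpoint of its neighbours, so the values of
  \<open>f\<close> satisfy the recurrence that makes each value twice the previous one minus the one
  before. Its solutions are arithmetic progressions. Only the terms themselves have to lie in
  \<open>S\<close>.\<close>

lemma midpoint_hom_progression:
  fixes f :: "'a::real_vector \<Rightarrow> 'b::real_vector"
  assumes hom: "\<And>x y. x \<in> S \<Longrightarrow> y \<in> S \<Longrightarrow> f (midpoint x y) = midpoint (f x) (f y)"
    and mem: "\<And>r. r \<le> N \<Longrightarrow> x + real r *\<^sub>R h \<in> S"
    and "r \<le> N"
  shows "f (x + real r *\<^sub>R h) = f x + real r *\<^sub>R (f (x + h) - f x)"
  using \<open>r \<le> N\<close>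
proof (induction r rule: induct_nat_012)
  case (ge2 r)
  let ?d = "f (x + h) - f x"
  have "midpoint (x + real r *\<^sub>R h) (x + real (Suc (Suc r)) *\<^sub>R h) = x + real (Suc r) *\<^sub>R h"
    by (simp add: midpoint_eq_iff algebra_simps scaleR_2)
  then have "midpoint (f (x + real r *\<^sub>R h)) (f (x + real (Suc (Suc r)) *\<^sub>R h)) =
      f (x + real (Suc r) *\<^sub>R h)"
    using hom[OF mem[of r] mem[of "Suc (Suc r)"]] ge2.prems by simp
  then have "f (x + real (Suc (Suc r)) *\<^sub>R h) =
      2 *\<^sub>R f (x + real (Suc r) *\<^sub>R h) - f (x + real r *\<^sub>R h)"
    by (simp only: midpoint_eq_iff scaleR_2) (simp only: eq_diff_eq add.commute)
  also have "\<dots> = 2 *\<^sub>R (f x + real (Suc r) *\<^sub>R ?d) -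
      (f x + real r *\<^sub>R ?d)"
    using ge2 by simp
  also have "\<dots> = f x + real (Suc (Suc r)) *\<^sub>R ?d"
  proof -
    have "2 *\<^sub>R (y + real (Suc r) *\<^sub>R d) - (y + real r *\<^sub>R d) = y + real (Suc (Suc r)) *\<^sub>R d" for y d :: 'b
      by (simp add: algebra_simps scaleR_2 del: scaleR_scaleR)
    then show ?thesis .
  qed
  finally show ?case .
qed simp_all

lemma midpoint_hom_multiple:
  fixes f :: "real ^ 2 \<Rightarrow> 'b::real_vector"
  assumes hom: "\<And>x y. x \<in> K \<inter> dyadic_plane \<Longrightarrow> y \<in> K \<inter> dyadic_plane \<Longrightarrow>
      f (midpoint x y) = midpoint (f x) (f y)"
    and K: "convex K" "0 \<in> K" and h: "h \<in> dyadic_plane" "real N *\<^sub>R h \<in> K"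
  shows "f (real N *\<^sub>R h) - f 0 = real N *\<^sub>R (f h - f 0)"
proof -
  have "0 + real r *\<^sub>R h \<in> K \<inter> dyadic_plane" if "r \<le> N" for r
  proof
    \<comment> \<open>The point \<open>r h\<close> divides the segment from 0 to \<open>N h\<close>
      in the ratio \<open>r / N\<close>, so convexity supplies every intermediate term from the last
      one.\<close>
    have "(real r / real N) *\<^sub>R (real N *\<^sub>R h) \<in> K"
      using convexD_alt[OF K h(2), of "real r / real N"] that
      by (cases "N = 0") (simp_all add: divide_le_eq_1 del: scaleR_scaleR)
    then show "0 + real r *\<^sub>R h \<in> K"
      using that K(2) by (cases "N = 0") simp_all
    show "0 + real r *\<^sub>R h \<in> dyadic_plane"
      using dyadic_plane_scaleR[OF dyadics_of_int[of "int r"] h(1)] by simp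
  qed
  from midpoint_hom_progression[of "K \<inter> dyadic_plane" f N 0 h N, OF hom this] show ?thesis
    by simp
qed

text \<open>The diagonals of the parallelogram with vertices 0, \<open>x\<close>,
  \<open>x + y\<close>, \<open>y\<close> share their midpoint; equating the two expressions for its
  image gives additivity.\<close>

lemma midpoint_hom_add:
  fixes f :: "'a::real_vector \<Rightarrow> 'b::real_vector"
  assumes hom: "\<And>x y. x \<in> S \<Longrightarrow> y \<in> S \<Longrightarrow> f (midpoint x y) = midpoint (f x) (f y)"
    and "0 \<in> S" "x \<in> S" "y \<in> S" "x + y \<in> S"
  shows "f (x + y) - f 0 = (f x - f 0) + (f y - f 0)"
proof -
  have "midpoint (f x) (f y) = midpoint (f 0) (f (x + y))"
    using assms by (metis add_0 midpoint_def)
  then have "f x + f y = f 0 + f (x + y)"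
    by (simp add: midpoint_def)
  then show ?thesis by (simp add: algebra_simps)
qed

section \<open>Vertex images of a homomorphism defined on a hat\<close>

lemma origin_triangle_iff:
  "x \<in> convex hull {0, Q, R} \<longleftrightarrow>
     (\<exists>u v. 0 \<le> u \<and> 0 \<le> v \<and> u + v \<le> 1 \<and> x = u *\<^sub>R Q + v *\<^sub>R R)"
  by (auto simp: convex_hull_3_alt)

lemma int_point_0: "int_point 0 0 = 0"
  by (simp add: vec_eq_iff forall_2)

text \<open>The vectors \<open>w1\<close> and \<open>w2\<close> play the role of the images of (1,0)
  and (0,1) under a linear part of \<open>f\<close>. The point (1,0) lies in the hat since
  \<open>m >= 1\<close>, but (0,1) may lie outside even the cone spanned by the hat at the origin.
  Hence \<open>w2\<close> is obtained indirectly, from a small multiple of (|i|,1).\<close>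

lemma hat_hom_basis_images:
  fixes f :: "real ^ 2 \<Rightarrow> real ^ 2"
  assumes "j > 0" "m > 0"
    and hom: "\<And>x y. x \<in> hat i j m \<Longrightarrow> y \<in> hat i j m \<Longrightarrow>
      f (midpoint x y) = midpoint (f x) (f y)"
    and into: "f ` hat i j m \<subseteq> dyadic_plane"
  obtains w1 w2 where "w1 \<in> dyadic_plane" "w2 \<in> dyadic_plane"
    "f (int_point m 0) - f 0 = of_int m *\<^sub>R w1"
    "f (int_point i j) - f 0 = of_int i *\<^sub>R w1 + of_int j *\<^sub>R w2"
proof -
  define K where "K = convex hull {0, int_point i j, int_point m 0}"
  have hat: "hat i j m = K \<inter> dyadic_plane"
    by (simp add: hat_def dyadic_triangle_def K_def int_point_0)
  have conv: "convex K" and K_0: "0 \<in> K"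
    by (auto simp: K_def hull_inc)
  have hat_0: "0 \<in> hat i j m"
    using K_0 int_point_dyadic[of 0 0] by (simp add: hat int_point_0)
  have mult: "f (real r *\<^sub>R h) - f 0 = real r *\<^sub>R (f h - f 0)"
    if "h \<in> dyadic_plane" "real r *\<^sub>R h \<in> K" for h r
    using hom conv K_0 that by (intro midpoint_hom_multiple[of K]) (simp_all add: hat)
  define \<phi> where "\<phi> x = f x - f 0" for x
  define e where "e = int_point 1 0"
  \<comment> \<open>\<open>N\<close> is the coefficient in j (|i|,1) = (i,j) + N (1,0). It is
    nonnegative because j >= 1, so \<open>nat\<close> does not truncate.\<close>
  define N where "N = nat (j * \<bar>i\<bar> - i)"
  have "i \<le> j * \<bar>i\<bar>"
    using assms(1) by (smt (verit) mult_right_mono mult_cancel_right1)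
  then have N: "real N = of_int j * of_int \<bar>i\<bar> - of_int i"
    by (simp add: N_def)
  \<comment> \<open>A power of two keeps \<open>s\<close> dyadic and lets the integer factor
    \<open>2 ^ Suc N\<close> undo the scaling. The exponent gives s (N + 1) <= 1, which bounds the
    total weight of \<open>j u\<close> in the hat.\<close>
  define s where "s = (1 :: real) / 2 ^ Suc N"
  have s_inv: "real (2 ^ Suc N) *\<^sub>R (s *\<^sub>R x) = x" for x :: "real ^ 2"
    by (simp add: s_def)
  have s: "s \<in> dyadics" "0 < s"
    using dyadics_inverse_two_power[of "Suc N"] by (simp_all add: s_def)
  have sN: "s * (real N + 1) \<le> 1"
  proof -
    have "Suc N \<le> 2 ^ Suc N"
      by (rule less_imp_le[OF less_exp])
    then have "real (Suc N) \<le> real (2 ^ Suc N)"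
      by (simp only: of_nat_le_iff)
    then show ?thesis by (simp add: s_def field_simps)
  qed
  \<comment> \<open>\<open>\<bar>i\<bar>\<close> makes \<open>u\<close> lie in the cone of the hat at the origin, and \<open>s\<close> makes \<open>j u\<close> small enough
    to lie in the hat itself.\<close>
  define u where "u = s *\<^sub>R int_point \<bar>i\<bar> 1"
  \<comment> \<open>The division by \<open>m\<close> appears because the third vertex is
    \<open>m e\<close>.\<close>
  have memK: "a *\<^sub>R int_point i j + b *\<^sub>R e \<in> K" if "0 \<le> a" "0 \<le> b" "a + b / of_int m \<le> 1" for a b
    unfolding K_def origin_triangle_iff using that assms
    by (intro exI[of _ a] exI[of _ "b / of_int m"]) (auto simp: vec_eq_iff forall_2 e_def)
  \<comment> \<open>Both summands lie in the hat, as does their sum, so additivity will apply to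
    this decomposition.\<close>
  have ju: "of_int j *\<^sub>R u = s *\<^sub>R int_point i j + real N *\<^sub>R (s *\<^sub>R e)"
    by (simp add: vec_eq_iff forall_2 u_def e_def N algebra_simps)
  have m: "s * real N / of_int m \<le> s * real N"
    using s assms mult_left_mono[of 1 "of_int m" "s * real N"] by (simp add: divide_le_eq)
  have K_ju: "of_int j *\<^sub>R u \<in> K"
    using memK[of s "s * real N"] s sN m by (simp add: ju algebra_simps)
  have K_sB: "s *\<^sub>R int_point i j \<in> K"
    using memK[of s 0] s sN by (simp add: algebra_simps)
       (smt (verit) mult_nonneg_nonneg of_nat_0_le_iff)
  have K_Ne: "real N *\<^sub>R (s *\<^sub>R e) \<in> K"
    using memK[of 0 "s * real N"] s sN m by (simp add: algebra_simps)
  have K_e: "e \<in> K"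
    using memK[of 0 1] assms by simp
  have K_B: "int_point i j \<in> K"
    by (simp add: K_def hull_inc)
  have me: "int_point m 0 = real (nat m) *\<^sub>R e"
    using assms by (simp add: vec_eq_iff forall_2 e_def)
  have K_C: "real (nat m) *\<^sub>R e \<in> K"
    by (simp add: K_def hull_inc flip: me)
  have dy: "e \<in> dyadic_plane" "u \<in> dyadic_plane"
    using s by (auto simp: e_def u_def intro!: dyadic_plane_scaleR)
  then have dy_s: "s *\<^sub>R e \<in> dyadic_plane" "s *\<^sub>R int_point i j \<in> dyadic_plane"
    using s by (auto intro!: dyadic_plane_scaleR)
  have natj: "real (nat j) = of_int j"
    using assms by simp
  have \<phi>_C: "\<phi> (int_point m 0) = of_int m *\<^sub>R \<phi> e"
    using mult[OF dy(1) K_C] assms by (simp add: \<phi>_def me)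
  have \<phi>_e: "\<phi> e = 2 ^ Suc N *\<^sub>R \<phi> (s *\<^sub>R e)"
    using mult[OF dy_s(1), of "2 ^ Suc N", unfolded s_inv, OF K_e] by (simp add: \<phi>_def)
  have \<phi>_B: "\<phi> (int_point i j) = 2 ^ Suc N *\<^sub>R \<phi> (s *\<^sub>R int_point i j)"
    using mult[OF dy_s(2), of "2 ^ Suc N", unfolded s_inv, OF K_B] by (simp add: \<phi>_def)
  have \<phi>_Ne: "\<phi> (real N *\<^sub>R (s *\<^sub>R e)) = real N *\<^sub>R \<phi> (s *\<^sub>R e)"
    using mult[OF dy_s(1) K_Ne] by (simp add: \<phi>_def)
  have \<phi>_ju: "\<phi> (of_int j *\<^sub>R u) = of_int j *\<^sub>R \<phi> u"
    using mult[OF dy(2), of "nat j", unfolded natj, OF K_ju] by (simp add: \<phi>_def)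
  have "real N *\<^sub>R (s *\<^sub>R e) \<in> dyadic_plane"
    using dyadic_plane_scaleR[OF dyadics_of_int[of "int N"] dy_s(1)] by simp
  moreover have "of_int j *\<^sub>R u \<in> dyadic_plane"
    using dyadic_plane_scaleR[OF dyadics_of_int dy(2)] .
  ultimately have "\<phi> (of_int j *\<^sub>R u) = \<phi> (s *\<^sub>R int_point i j) + \<phi> (real N *\<^sub>R (s *\<^sub>R e))"
    unfolding \<phi>_def ju
    using K_ju[unfolded ju] K_sB K_Ne dy_s hat_0
    by (intro midpoint_hom_add[where S = "hat i j m"] hom) (simp_all add: hat ju)
  then have "of_int j *\<^sub>R \<phi> u = \<phi> (s *\<^sub>R int_point i j) + real N *\<^sub>R \<phi> (s *\<^sub>R e)"
    by (simp only: \<phi>_ju \<phi>_Ne)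
  then have "2 ^ Suc N *\<^sub>R (of_int j *\<^sub>R \<phi> u) =
      2 ^ Suc N *\<^sub>R (\<phi> (s *\<^sub>R int_point i j) + real N *\<^sub>R \<phi> (s *\<^sub>R e))"
    by (rule arg_cong)
  \<comment> \<open>Multiplying by \<open>2 ^ Suc N\<close> replaces the values at the shrunken
    points \<open>s (i,j)\<close> and \<open>s e\<close> by those at (i,j) and
    \<open>e\<close>.\<close>
  then have key: "of_int j *\<^sub>R (2 ^ Suc N *\<^sub>R \<phi> u) = \<phi> (int_point i j) + real N *\<^sub>R \<phi> e"
    by (simp add: \<phi>_e \<phi>_B scaleR_add_right mult.commute mult.left_commute)
  have \<phi>_dy: "\<phi> x \<in> dyadic_plane" if "x \<in> hat i j m" for x
    unfolding \<phi>_def using that hat_0 into by (intro dyadic_plane_diff) auto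
  have "u \<in> K"
    using convexD_alt[OF conv K_0 K_ju, of "1 / of_int j"] assms by simp
  have dy_pow: "2 ^ Suc N \<in> dyadics"
    using dyadics_of_int[of "2 ^ Suc N"] by simp
  show ?thesis
  \<comment> \<open>Here \<open>2 ^ Suc N\<close> times the displacement of \<open>u\<close> is the
    extrapolated image of (|i|,1), and (0,1) = (|i|,1) - |i| (1,0).\<close>
  proof (rule that[of "\<phi> e" "2 ^ Suc N *\<^sub>R \<phi> u - of_int \<bar>i\<bar> *\<^sub>R \<phi> e"])
    show "\<phi> e \<in> dyadic_plane"
      using K_e dy by (intro \<phi>_dy) (simp add: hat)
    then show "2 ^ Suc N *\<^sub>R \<phi> u - of_int \<bar>i\<bar> *\<^sub>R \<phi> e \<in> dyadic_plane"
      using \<open>u \<in> K\<close> K_e dy dy_pow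
      by (intro dyadic_plane_diff dyadic_plane_scaleR \<phi>_dy) (simp_all add: hat del: of_int_abs)
    show "f (int_point m 0) - f 0 = of_int m *\<^sub>R \<phi> e"
      using \<phi>_C by (simp add: \<phi>_def)
    have "\<phi> (int_point i j) =
        of_int i *\<^sub>R \<phi> e + of_int j *\<^sub>R (2 ^ Suc N *\<^sub>R \<phi> u - of_int \<bar>i\<bar> *\<^sub>R \<phi> e)"
      unfolding scaleR_diff_right key N by (simp add: algebra_simps)
    then show "f (int_point i j) - f 0 =
        of_int i *\<^sub>R \<phi> e + of_int j *\<^sub>R (2 ^ Suc N *\<^sub>R \<phi> u - of_int \<bar>i\<bar> *\<^sub>R \<phi> e)"
      by (simp add: \<phi>_def)
  qed
qed

section \<open>Unimodular affine maps and the criterion for vertex images\<close>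

text \<open>An integer matrix of determinant 1 or -1 has an integer inverse, so \<open>g\<close> and
  its inverse both preserve the dyadic plane; being affine, \<open>g\<close> also commutes with
  convex hulls and midpoints.\<close>

lemma unimodular_dyadic_triangle_iso:
  fixes a b c d p q :: int
  defines "g \<equiv> \<lambda>x. int_point p q + x $ 1 *\<^sub>R int_point a b + x $ 2 *\<^sub>R int_point c d"
  assumes det: "\<bar>a * d - b * c\<bar> = 1"
  shows "groupoid_iso g (dyadic_triangle P Q R) (dyadic_triangle (g P) (g Q) (g R))"
proof -
  define D where "D = a * d - b * c"
  have "D * D = 1"
    using det by (metis D_def abs_mult_self_eq mult_1)
  then have D: "of_int D * of_int D = (1 :: real)"
    by (metis of_int_1 of_int_mult)
  have D_eq: "of_int D = (of_int a * of_int d - of_int b * of_int c :: real)"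
    by (simp add: D_def)
  \<comment> \<open>Cramer's rule, with \<open>D\<close> in place of its reciprocal because
    \<open>D * D = 1\<close>.\<close>
  have inv: "x $ 1 = of_int D * (of_int d * (g x $ 1 - of_int p) - of_int c * (g x $ 2 - of_int q))"
            "x $ 2 = of_int D * (of_int a * (g x $ 2 - of_int q) - of_int b * (g x $ 1 - of_int p))" for x
  proof -
    have "of_int D * (of_int d * (g x $ 1 - of_int p) - of_int c * (g x $ 2 - of_int q)) =
        of_int D * of_int D * x $ 1"
      by (simp add: g_def D_eq algebra_simps)
    then show "x $ 1 = of_int D * (of_int d * (g x $ 1 - of_int p) - of_int c * (g x $ 2 - of_int q))"
      using D by simp
    have "of_int D * (of_int a * (g x $ 2 - of_int q) - of_int b * (g x $ 1 - of_int p)) =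
        of_int D * of_int D * x $ 2"
      by (simp add: g_def D_eq algebra_simps)
    then show "x $ 2 = of_int D * (of_int a * (g x $ 2 - of_int q) - of_int b * (g x $ 1 - of_int p))"
      using D by simp
  qed
  have "inj g"
  proof (rule injI)
    fix x y assume "g x = g y"
    then have "x $ 1 = y $ 1" "x $ 2 = y $ 2"
      by (simp_all only: inv[of x] inv[of y])
    then show "x = y" by (simp add: vec_eq_iff forall_2)
  qed
  have dy: "g x \<in> dyadic_plane \<longleftrightarrow> x \<in> dyadic_plane" for x
  proof
    show "x \<in> dyadic_plane" if "g x \<in> dyadic_plane"
      using that unfolding dyadic_plane_iff
      by (subst inv, subst inv(2)) (auto intro!: dyadics_mult dyadics_diff)
    show "g x \<in> dyadic_plane" if "x \<in> dyadic_plane"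
      using that unfolding dyadic_plane_iff g_def
      by (auto intro!: dyadics_mult dyadics_add)
  qed
  define h where "h x = x $ 1 *\<^sub>R int_point a b + x $ 2 *\<^sub>R int_point c d" for x :: "real ^ 2"
  have "linear h"
    by (rule linearI) (simp_all add: h_def algebra_simps)
  have g: "g x = int_point p q + h x" for x
    by (simp add: g_def h_def add.assoc)
  have "g ` (convex hull S) = convex hull (g ` S)" for S
    unfolding g by (metis (no_types) \<open>linear h\<close> convex_hull_linear_image convex_hull_translation image_image)
  from this[of "{P, Q, R}"] have "g ` dyadic_triangle P Q R = dyadic_triangle (g P) (g Q) (g R)"
    unfolding dyadic_triangle_def using dy by fastforce
  moreover have "g (midpoint x y) = midpoint (g x) (g y)" for x y
    by (simp add: g_def midpoint_def algebra_simps vec_eq_iff forall_2)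
  ultimately show ?thesis
    using \<open>inj g\<close> by (auto simp: groupoid_iso_def bij_betw_def intro: inj_on_subset)
qed

text \<open>The images are arbitrary integral points, not yet matched with the vertices of a hat, so
  that one criterion serves all six kinds. The assumption \<open>area\<close> equates the doubled
  areas of the two triangles.\<close>

lemma hat_iso_iff:
  fixes i j m :: int
  assumes jm: "j > 0" "odd j" "m > 0" "odd m"
    and area: "\<bar>(r1 - p1) * (q2 - p2) - (r2 - p2) * (q1 - p1)\<bar> = j * m"
  shows "(\<exists>f. groupoid_iso f (hat i j m)
              (dyadic_triangle (int_point p1 p2) (int_point q1 q2) (int_point r1 r2)) \<and>
            f (int_point 0 0) = int_point p1 p2 \<and> f (int_point i j) = int_point q1 q2 \<and>
            f (int_point m 0) = int_point r1 r2) \<longleftrightarrow>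
         (\<exists>a b c d. r1 - p1 = m * a \<and> r2 - p2 = m * b \<and>
            q1 - p1 = i * a + j * c \<and> q2 - p2 = i * b + j * d)"
    (is "?L \<longleftrightarrow> ?R")
proof
  assume ?L
  then obtain f where f: "groupoid_iso f (hat i j m)
      (dyadic_triangle (int_point p1 p2) (int_point q1 q2) (int_point r1 r2))"
    "f 0 = int_point p1 p2" "f (int_point i j) = int_point q1 q2"
    "f (int_point m 0) = int_point r1 r2"
    by (auto simp: int_point_0)
  obtain w1 w2 where w: "w1 \<in> dyadic_plane" "w2 \<in> dyadic_plane"
    "f (int_point m 0) - f 0 = of_int m *\<^sub>R w1"
    "f (int_point i j) - f 0 = of_int i *\<^sub>R w1 + of_int j *\<^sub>R w2"
  proof (rule hat_hom_basis_images[OF jm(1,3)])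
    show "f (midpoint x y) = midpoint (f x) (f y)" if "x \<in> hat i j m" "y \<in> hat i j m" for x y
      using f(1) that by (simp add: groupoid_iso_def)
    show "f ` hat i j m \<subseteq> dyadic_plane"
      using f(1) by (auto simp: groupoid_iso_def bij_betw_def dyadic_triangle_def)
  qed blast
  have w1: "of_int m * w1 $ 1 = of_int (r1 - p1)" "of_int m * w1 $ 2 = of_int (r2 - p2)"
    using w(3) by (simp_all add: f vec_eq_iff forall_2)
  then obtain a b where ab: "w1 $ 1 = of_int a" "w1 $ 2 = of_int b"
    using w(1) jm(4) unfolding dyadic_plane_iff by (metis dyadic_odd_multiple_int Ints_cases)
  have w2: "of_int j * w2 $ 1 = of_int (q1 - p1 - i * a)" "of_int j * w2 $ 2 = of_int (q2 - p2 - i * b)"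
    using w(4) by (simp_all add: f vec_eq_iff forall_2 ab)
  then obtain c d where cd: "w2 $ 1 = of_int c" "w2 $ 2 = of_int d"
    using w(2) jm(2) unfolding dyadic_plane_iff by (metis dyadic_odd_multiple_int Ints_cases)
  from w1 w2 have "m * a = r1 - p1" "m * b = r2 - p2" "j * c = q1 - p1 - i * a" "j * d = q2 - p2 - i * b"
    unfolding ab cd by (simp_all only: of_int_eq_iff flip: of_int_mult)
  then show ?R by (intro exI[of _ a] exI[of _ b] exI[of _ c] exI[of _ d]) auto
next
  assume ?R
  then obtain a b c d where abcd: "r1 - p1 = m * a" "r2 - p2 = m * b"
    "q1 - p1 = i * a + j * c" "q2 - p2 = i * b + j * d"
    by blast
  \<comment> \<open>The doubled area of the image is \<open>j m\<close> times the absolute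
    determinant, so equal areas force the determinant to be 1 or -1.\<close>
  have "j * m * \<bar>a * d - b * c\<bar> = \<bar>j * m * (a * d - b * c)\<bar>"
    using jm by (simp add: abs_mult)
  also have "j * m * (a * d - b * c) = (r1 - p1) * (q2 - p2) - (r2 - p2) * (q1 - p1)"
    unfolding abcd by (simp add: algebra_simps)
  also note area
  finally have det: "\<bar>a * d - b * c\<bar> = 1"
    using jm by simp
  define g where "g x = int_point p1 p2 + x $ 1 *\<^sub>R int_point a b + x $ 2 *\<^sub>R int_point c d"
    for x :: "real ^ 2"
  have eq: "p1 + m * a = r1" "p2 + m * b = r2" "p1 + i * a + j * c = q1" "p2 + i * b + j * d = q2"
    using abcd by auto
  have g: "g (int_point x y) = int_point (p1 + x * a + y * c) (p2 + x * b + y * d)" for x y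
    by (simp add: g_def vec_eq_iff forall_2)
  have "groupoid_iso g (hat i j m)
      (dyadic_triangle (int_point p1 p2) (int_point q1 q2) (int_point r1 r2))"
    using unimodular_dyadic_triangle_iso[OF det, of p1 p2 "int_point 0 0" "int_point i j" "int_point m 0",
        folded g_def] by (simp add: hat_def g eq)
  moreover have "g (int_point 0 0) = int_point p1 p2" "g (int_point i j) = int_point q1 q2"
    "g (int_point m 0) = int_point r1 r2"
    by (simp_all add: g eq)
  ultimately show ?L by blast
qed

section \<open>Area of a hat\<close>

lemma hull_dyadic_triangle:
  assumes "P \<in> dyadic_plane" "Q \<in> dyadic_plane" "R \<in> dyadic_plane"
  shows "convex hull (dyadic_triangle P Q R) = convex hull {P, Q, R}"
proof (rule subset_antisym)
  show "convex hull (dyadic_triangle P Q R) \<subseteq> convex hull {P, Q, R}"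
    unfolding dyadic_triangle_def by (rule hull_minimal) auto
  show "convex hull {P, Q, R} \<subseteq> convex hull (dyadic_triangle P Q R)"
    using assms unfolding dyadic_triangle_def by (intro hull_mono) (auto simp: hull_inc)
qed

lemma hat_area:
  assumes "j > 0" "m > 0"
  shows "measure lebesgue (convex hull (hat i j m)) = of_int (j * m) / 2"
proof -
  let ?H = "convex hull {int_point 0 0, int_point i j, int_point m 0}"
  have "compact ?H"
    by (intro finite_imp_compact_convex_hull) simp
  then have "measure lebesgue ?H = measure lborel ?H"
    by (intro measure_completion) (simp add: borel_compact)
  then show ?thesis
    using assms by (simp add: hat_def hull_dyadic_triangle content_triangle abs_mult)
qed

section \<open>Integer equations behind the two basic kinds of vertex map\<close>

text \<open>When the base goes to the base, \<open>b = 0\<close> and the matrix is triangular. Equal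
  areas then give \<open>a * d = 1\<close>, positivity gives \<open>a = d = 1\<close>, and what
  remains is a shear with parameter \<open>p = c\<close>.\<close>

lemma base_preserving_iff:
  fixes i j k l m n :: int
  assumes "j > 0" "m > 0" "l > 0" "n > 0" "j * m = l * n"
  shows "(\<exists>a b c d. n = m * a \<and> 0 = m * b \<and> k = i * a + j * c \<and> l = i * b + j * d) \<longleftrightarrow>
         l = j \<and> n = m \<and> (\<exists>p. k = i + j * p)"
    (is "?L \<longleftrightarrow> ?R")
proof
  assume ?L
  then obtain a c d where *: "n = m * a" "k = i * a + j * c" "l = j * d"
    using assms by auto
  then have "j * m * (a * d) = j * m"
    using assms(5) by (simp add: algebra_simps)
  then have "a * d = 1"
    using assms by simp
  moreover have "a > 0"
    using * assms by (simp add: zero_less_mult_iff)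
  ultimately have "a = 1" "d = 1"
    by (auto simp: zmult_eq_1_iff)
  with * show ?R by auto
next
  assume ?R
  then obtain p where "l = j" "n = m" "k = i + j * p" by blast
  then show ?L
    by (intro exI[of _ 1] exI[of _ 0] exI[of _ p] exI[of _ 1]) auto
qed

text \<open>Here (m,0) goes to (k,l) and (i,j) goes to (n,0). Comparing areas yields
  \<open>j = b n\<close>, and then the second coordinate of the image of (i,j) yields
  \<open>i = - n d\<close>, so \<open>n\<close> divides both \<open>i\<close> and \<open>j\<close>;
  the equation for \<open>n\<close> is a Bezout relation, so the gcd divides \<open>n\<close> as
  well.\<close>

lemma base_moving_iff:
  fixes i j k l m n :: int
  assumes "j > 0" "m > 0" "l > 0" "n > 0" "j * m = l * n"
  shows "(\<exists>a b c d. k = m * a \<and> l = m * b \<and> n = i * a + j * c \<and> 0 = i * b + j * d) \<longleftrightarrow>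
         n = gcd i j \<and> real_of_int l = real_of_int (m * j) / real_of_int n \<and>
         (\<exists>a. [a * i = n] (mod j) \<and> k = a * m)"
    (is "?L \<longleftrightarrow> ?R")
proof
  assume ?L
  then obtain a b c d where *: "k = m * a" "l = m * b" "n = i * a + j * c" "0 = i * b + j * d"
    by blast
  have j: "j = b * n"
    using assms * by simp
  then have "b \<noteq> 0" using assms by auto
  have "b * (i + n * d) = 0"
    using *(4) by (simp add: j algebra_simps)
  then have "i = n * (- d)"
    using \<open>b \<noteq> 0\<close> by simp
  then have "n dvd gcd i j"
    using j by simp
  moreover have "gcd i j dvd n"
    unfolding *(3) by (intro dvd_add dvd_mult2) simp_all
  ultimately have "n = gcd i j"
    using assms by (simp add: zdvd_antisym_nonneg)
  moreover have "real_of_int l = real_of_int (m * j) / real_of_int n"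
    using assms by (simp add: divide_simps mult.commute flip: of_int_mult)
  moreover have "[a * i = n] (mod j)"
    unfolding *(3) by (simp add: cong_iff_lin mult.commute)
  ultimately show ?R
    using *(1) by (auto simp: mult.commute)
next
  assume ?R
  then obtain a where n: "n = gcd i j" and a: "[a * i = n] (mod j)" "k = a * m"
    by blast
  \<comment> \<open>The congruence is read back as a Bezout relation; the second column of the
    matrix will be \<open>b = j / n\<close> and \<open>d = - i / n\<close>.\<close>
  from a(1) obtain c where c: "n = a * i + j * c"
    by (auto simp: cong_iff_lin)
  obtain b e where be: "j = n * b" "i = n * e"
    unfolding n by (meson dvdE gcd_dvd1 gcd_dvd2)
  have "n * (m * b) = n * l"
    using assms(5) by (simp add: be(1) algebra_simps)
  then have "l = m * b"
    using assms by simp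
  moreover have "0 = i * b + j * (- e)"
    by (simp add: be)
  ultimately show ?L
    using a(2) c by (metis mult.commute)
qed

section \<open>The six vertex bijections\<close>

theorem theorem6p3:
  fixes i j m k l n :: int
    and T T' :: "(real ^ 2) set"
    and A B C A' B' C' :: "real ^ 2"
    and \<iota> :: "real ^ 2 \<Rightarrow> real ^ 2"
  assumes "j > 0" "odd j" "m > 0" "odd m" "l > 0" "odd l" "n > 0" "odd n"
    and "T = hat i j m"
    and "T' = hat k l n"
    and "A = int_point 0 0" "B = int_point i j" "C = int_point m 0"
    and "boundary_type T = boundary_type T' \<or>
         oppositely_oriented (boundary_type T) (boundary_type T')"
    and "measure lebesgue (convex hull T) = measure lebesgue (convex hull T')"
    and "bij_betw \<iota> (hat_vertices i j m) (hat_vertices k l n)"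
    and "A' = \<iota> A" "B' = \<iota> B" "C' = \<iota> C"
  shows "(maps_onto_hat k l n A' B' C' \<or> maps_onto_hat k l n C' B' A' \<or>
          maps_onto_hat k l n A' C' B' \<or> maps_onto_hat k l n C' A' B' \<or>
          maps_onto_hat k l n B' C' A' \<or> maps_onto_hat k l n B' A' C')
    \<and> (maps_onto_hat k l n A' B' C' \<longrightarrow>
        (extends_to_iso \<iota> (hat_vertices i j m) T T' \<longleftrightarrow> l = j \<and> n = m \<and> (\<exists>p. k = i + j * p)))
    \<and> (maps_onto_hat k l n C' B' A' \<longrightarrow>
        (extends_to_iso \<iota> (hat_vertices i j m) T T' \<longleftrightarrow> l = j \<and> n = m \<and> (\<exists>p. k = m - i + j * p)))
    \<and> (maps_onto_hat k l n A' C' B' \<longrightarrow>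
        (extends_to_iso \<iota> (hat_vertices i j m) T T' \<longleftrightarrow>
          n = gcd i j \<and> real_of_int l = real_of_int (m * j) / real_of_int n \<and>
          (\<exists>a. [a * i = n] (mod j) \<and> k = a * m)))
    \<and> (maps_onto_hat k l n C' A' B' \<longrightarrow>
        (extends_to_iso \<iota> (hat_vertices i j m) T T' \<longleftrightarrow>
          n = gcd (m - i) j \<and> real_of_int l = real_of_int (m * j) / real_of_int n \<and>
          (\<exists>a. [a * (m - i) = n] (mod j) \<and> k = a * m)))
    \<and> (maps_onto_hat k l n B' C' A' \<longrightarrow>
        (extends_to_iso \<iota> (hat_vertices i j m) T T' \<longleftrightarrow>
          n = gcd i j \<and> real_of_int l = real_of_int (m * j) / real_of_int n \<and>
          (\<exists>a. [a * i = n] (mod j) \<and> k = n - a * m)))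
    \<and> (maps_onto_hat k l n B' A' C' \<longrightarrow>
        (extends_to_iso \<iota> (hat_vertices i j m) T T' \<longleftrightarrow>
          n = gcd (m - i) j \<and> real_of_int l = real_of_int (m * j) / real_of_int n \<and>
          (\<exists>a. [a * (m - i) = n] (mod j) \<and> k = n - a * m)))"
proof -
  \<comment> \<open>The hull depends only on the set of vertices, so \<open>T'\<close> can be
    written with the images in the order \<open>A'\<close>, \<open>B'\<close>, \<open>C'\<close>
    whatever their positions in the hat.\<close>
  have T: "T = dyadic_triangle A B C" and T': "T' = dyadic_triangle A' B' C'"
  proof -
    show "T = dyadic_triangle A B C"
      using assms by (simp add: hat_def)
    have "{A', B', C'} = \<iota> ` hat_vertices i j m"
      using assms by (simp add: hat_vertices_def)
    also have "\<dots> = {int_point 0 0, int_point k l, int_point n 0}"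
      using assms(16) by (simp add: bij_betw_def hat_vertices_def)
    finally show "T' = dyadic_triangle A' B' C'"
      by (simp add: assms hat_def dyadic_triangle_def)
  qed
  have area: "j * m = l * n"
  proof -
    have "of_int (j * m) / 2 = (of_int (l * n) / 2 :: real)"
      using assms(1-10,15) by (metis hat_area)
    then show ?thesis
      by (simp flip: of_int_mult)
  qed
  have area_flip: "m * j = n * l" "j * m = n * l" "m * j = l * n"
    using area by (simp_all add: mult.commute)
  have six: "maps_onto_hat k l n A' B' C' \<or> maps_onto_hat k l n C' B' A' \<or>
          maps_onto_hat k l n A' C' B' \<or> maps_onto_hat k l n C' A' B' \<or>
          maps_onto_hat k l n B' C' A' \<or> maps_onto_hat k l n B' A' C'"
  proof -
    have "A \<noteq> B" "B \<noteq> C" "A \<noteq> C"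
      using assms(1,3,11-13) by (auto simp: vec_eq_iff forall_2)
    then have "A' \<noteq> B'" "B' \<noteq> C'" "A' \<noteq> C'"
      using assms(11-13,16-19) by (auto simp: bij_betw_def hat_vertices_def)
    moreover have "{A', B', C'} = {int_point 0 0, int_point k l, int_point n 0}"
      using assms(11-13,16-19) by (simp add: bij_betw_def hat_vertices_def)
    ultimately show ?thesis
      unfolding maps_onto_hat_def by (simp add: set_eq_iff) metis
  qed
  have ext: "extends_to_iso \<iota> (hat_vertices i j m) T T' \<longleftrightarrow>
      (\<exists>a b c d. r1 - p1 = m * a \<and> r2 - p2 = m * b \<and>
         q1 - p1 = i * a + j * c \<and> q2 - p2 = i * b + j * d)"
    if "A' = int_point p1 p2" "B' = int_point q1 q2" "C' = int_point r1 r2"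
      and "\<bar>(r1 - p1) * (q2 - p2) - (r2 - p2) * (q1 - p1)\<bar> = j * m"
    for p1 p2 q1 q2 r1 r2
    using hat_iso_iff[OF assms(1-4) that(4)] assms(9,11-13,17-19) T' that(1-3)
    by (simp add: extends_to_iso_def hat_vertices_def)
  have a: "extends_to_iso \<iota> (hat_vertices i j m) T T' \<longleftrightarrow> l = j \<and> n = m \<and> (\<exists>p. k = i + j * p)"
    if "maps_onto_hat k l n A' B' C'"
  proof -
    have "extends_to_iso \<iota> (hat_vertices i j m) T T' \<longleftrightarrow>
        (\<exists>a b c d. n = m * a \<and> 0 = m * b \<and> k = i * a + j * c \<and> l = i * b + j * d)"
      using that assms area_flip by (subst ext[of 0 0 k l n 0]) (auto simp: maps_onto_hat_def abs_mult)
    then show ?thesis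
      using base_preserving_iff[OF assms(1,3,5,7) area] by simp
  qed
  have b: "extends_to_iso \<iota> (hat_vertices i j m) T T' \<longleftrightarrow> l = j \<and> n = m \<and> (\<exists>p. k = m - i + j * p)"
    if "maps_onto_hat k l n C' B' A'"
  proof -
    have "extends_to_iso \<iota> (hat_vertices i j m) T T' \<longleftrightarrow>
        (\<exists>a b c d. 0 - n = m * a \<and> 0 - 0 = m * b \<and> k - n = i * a + j * c \<and> l - 0 = i * b + j * d)"
      using that assms area_flip by (intro ext) (auto simp: maps_onto_hat_def abs_mult)
    \<comment> \<open>Reflecting the source by (x,y) -> (m - x, y) exchanges \<open>A\<close> and
      \<open>C\<close> and replaces \<open>i\<close> by \<open>m - i\<close>; on the matrix it
      negates the first row. This reduces the kind to the base-preserving one.\<close>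
    also have "\<dots> \<longleftrightarrow> (\<exists>a b c d. n = m * a \<and> 0 = m * b \<and>
        k = (m - i) * a + j * c \<and> l = (m - i) * b + j * d)" (is "?L \<longleftrightarrow> ?R")
    proof
      assume ?L
      then obtain a b c d where "0 - n = m * a" "0 - 0 = m * b" "k - n = i * a + j * c" "l - 0 = i * b + j * d"
        by blast
      then show ?R
        by (intro exI[of _ "- a"] exI[of _ "- b"] exI[of _ c] exI[of _ d]) (auto simp: algebra_simps)
    next
      assume ?R
      then obtain a b c d where "n = m * a" "0 = m * b" "k = (m - i) * a + j * c" "l = (m - i) * b + j * d"
        by blast
      then show ?L
        by (intro exI[of _ "- a"] exI[of _ "- b"] exI[of _ c] exI[of _ d]) (auto simp: algebra_simps)
    qed
    finally show ?thesis
      using base_preserving_iff[OF assms(1,3,5,7) area] by simp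
  qed
  have c: "extends_to_iso \<iota> (hat_vertices i j m) T T' \<longleftrightarrow>
      n = gcd i j \<and> real_of_int l = real_of_int (m * j) / real_of_int n \<and>
      (\<exists>a. [a * i = n] (mod j) \<and> k = a * m)"
    if "maps_onto_hat k l n A' C' B'"
  proof -
    have "extends_to_iso \<iota> (hat_vertices i j m) T T' \<longleftrightarrow>
        (\<exists>a b c d. k = m * a \<and> l = m * b \<and> n = i * a + j * c \<and> 0 = i * b + j * d)"
      using that assms area_flip by (subst ext[of 0 0 n 0 k l]) (auto simp: maps_onto_hat_def abs_mult)
    then show ?thesis
      using base_moving_iff[OF assms(1,3,5,7) area] by simp
  qed
  have d: "extends_to_iso \<iota> (hat_vertices i j m) T T' \<longleftrightarrow>
      n = gcd (m - i) j \<and> real_of_int l = real_of_int (m * j) / real_of_int n \<and>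
      (\<exists>a. [a * (m - i) = n] (mod j) \<and> k = a * m)"
    if "maps_onto_hat k l n C' A' B'"
  proof -
    have "extends_to_iso \<iota> (hat_vertices i j m) T T' \<longleftrightarrow>
        (\<exists>a b c d. 0 - k = m * a \<and> 0 - l = m * b \<and> n - k = i * a + j * c \<and> 0 - l = i * b + j * d)"
      using that assms area_flip by (intro ext) (auto simp: maps_onto_hat_def abs_mult algebra_simps)
    \<comment> \<open>The same source reflection reduces this kind to the one that fixes the origin
      and moves the base.\<close>
    also have "\<dots> \<longleftrightarrow> (\<exists>a b c d. k = m * a \<and> l = m * b \<and> n = (m - i) * a + j * c \<and> 0 = (m - i) * b + j * d)"
      (is "?L \<longleftrightarrow> ?R")
    proof
      assume ?L
      then obtain a b c d where "0 - k = m * a" "0 - l = m * b" "n - k = i * a + j * c" "0 - l = i * b + j * d"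
        by blast
      then show ?R
        by (intro exI[of _ "- a"] exI[of _ "- b"] exI[of _ c] exI[of _ d]) (auto simp: algebra_simps)
    next
      assume ?R
      then obtain a b c d where "k = m * a" "l = m * b" "n = (m - i) * a + j * c" "0 = (m - i) * b + j * d"
        by blast
      then show ?L
        by (intro exI[of _ "- a"] exI[of _ "- b"] exI[of _ c] exI[of _ d]) (auto simp: algebra_simps)
    qed
    also have "\<dots> \<longleftrightarrow> n = gcd (m - i) j \<and> real_of_int l = real_of_int (m * j) / real_of_int n \<and>
        (\<exists>a. [a * (m - i) = n] (mod j) \<and> k = a * m)"
      using base_moving_iff[OF assms(1,3,5,7) area] .
    finally show ?thesis .
  qed
  have e: "extends_to_iso \<iota> (hat_vertices i j m) T T' \<longleftrightarrow>
      n = gcd i j \<and> real_of_int l = real_of_int (m * j) / real_of_int n \<and>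
      (\<exists>a. [a * i = n] (mod j) \<and> k = n - a * m)"
    if "maps_onto_hat k l n B' C' A'"
  proof -
    have "extends_to_iso \<iota> (hat_vertices i j m) T T' \<longleftrightarrow>
        (\<exists>a b c d. k - n = m * a \<and> l - 0 = m * b \<and> 0 - n = i * a + j * c \<and> 0 - 0 = i * b + j * d)"
      using that assms area_flip by (intro ext) (auto simp: maps_onto_hat_def abs_mult algebra_simps)
    \<comment> \<open>Now the target is reflected by (x,y) -> (n - x, y), which replaces
      \<open>k\<close> by \<open>n - k\<close> and negates the first column of the matrix.\<close>
    also have "\<dots> \<longleftrightarrow> (\<exists>a b c d. (n - k) = m * a \<and> l = m * b \<and> n = i * a + j * c \<and> 0 = i * b + j * d)"
      (is "?L \<longleftrightarrow> ?R")
    proof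
      assume ?L
      then obtain a b c d where "k - n = m * a" "l - 0 = m * b" "0 - n = i * a + j * c" "0 - 0 = i * b + j * d"
        by blast
      then show ?R
        by (intro exI[of _ "- a"] exI[of _ b] exI[of _ "- c"] exI[of _ d]) (auto simp: algebra_simps)
    next
      assume ?R
      then obtain a b c d where "(n - k) = m * a" "l = m * b" "n = i * a + j * c" "0 = i * b + j * d"
        by blast
      then show ?L
        by (intro exI[of _ "- a"] exI[of _ b] exI[of _ "- c"] exI[of _ d]) (auto simp: algebra_simps)
    qed
    also have "\<dots> \<longleftrightarrow> n = gcd i j \<and> real_of_int l = real_of_int (m * j) / real_of_int n \<and>
        (\<exists>a. [a * i = n] (mod j) \<and> (n - k) = a * m)"
      using base_moving_iff[OF assms(1,3,5,7) area] .
    also have "(\<exists>a. [a * i = n] (mod j) \<and> (n - k) = a * m) \<longleftrightarrow>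
        (\<exists>a. [a * i = n] (mod j) \<and> k = n - a * m)"
      by (auto simp: algebra_simps)
    finally show ?thesis .
  qed
  have f: "extends_to_iso \<iota> (hat_vertices i j m) T T' \<longleftrightarrow>
      n = gcd (m - i) j \<and> real_of_int l = real_of_int (m * j) / real_of_int n \<and>
      (\<exists>a. [a * (m - i) = n] (mod j) \<and> k = n - a * m)"
    if "maps_onto_hat k l n B' A' C'"
  proof -
    have "extends_to_iso \<iota> (hat_vertices i j m) T T' \<longleftrightarrow>
        (\<exists>a b c d. n - k = m * a \<and> 0 - l = m * b \<and> 0 - k = i * a + j * c \<and> 0 - l = i * b + j * d)"
      using that assms area_flip by (intro ext) (auto simp: maps_onto_hat_def abs_mult algebra_simps)
    \<comment> \<open>Both reflections are combined: negating the first row and then the first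
      column restores \<open>a\<close> and changes the signs of \<open>b\<close> and
      \<open>c\<close>.\<close>
    also have "\<dots> \<longleftrightarrow> (\<exists>a b c d. (n - k) = m * a \<and> l = m * b \<and> n = (m - i) * a + j * c \<and> 0 = (m - i) * b + j * d)"
      (is "?L \<longleftrightarrow> ?R")
    proof
      assume ?L
      then obtain a b c d where "n - k = m * a" "0 - l = m * b" "0 - k = i * a + j * c" "0 - l = i * b + j * d"
        by blast
      then show ?R
        by (intro exI[of _ a] exI[of _ "- b"] exI[of _ "- c"] exI[of _ d]) (auto simp: algebra_simps)
    next
      assume ?R
      then obtain a b c d where "(n - k) = m * a" "l = m * b" "n = (m - i) * a + j * c" "0 = (m - i) * b + j * d"
        by blast
      then show ?L
        by (intro exI[of _ a] exI[of _ "- b"] exI[of _ "- c"] exI[of _ d]) (auto simp: algebra_simps)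
    qed
    also have "\<dots> \<longleftrightarrow> n = gcd (m - i) j \<and> real_of_int l = real_of_int (m * j) / real_of_int n \<and>
        (\<exists>a. [a * (m - i) = n] (mod j) \<and> (n - k) = a * m)"
      using base_moving_iff[OF assms(1,3,5,7) area] .
    also have "(\<exists>a. [a * (m - i) = n] (mod j) \<and> (n - k) = a * m) \<longleftrightarrow>
        (\<exists>a. [a * (m - i) = n] (mod j) \<and> k = n - a * m)"
      by (auto simp: algebra_simps)
    finally show ?thesis .
  qed
  show ?thesis
    using six a b c d e f by blast
qed

end
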